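(* Let $(M,g,\mathcal{E})$ be an embedded ambient structure and let $\xi,\eta$ be two tangent vectors to $M$ at $x\in M$. Define vector fields $p_\xi,p_\eta$ on $M$ by $p_\xi(y)=\Pi_{g,y}\xi$ and $p_\eta(y)=\Pi_{g,y}\eta$ for $y\in M$. Then $p_\xi(x)=\xi$, $p_\eta(x)=\eta$, and $$\Pi_{g,x}(D_\xi p_\eta)_x=0,\qquad [p_\xi,p_\eta]_x=0,\qquad (D_\xi\Pi_g)_x\eta=(D_\eta\Pi_g)_x\xi.$$
   Context: $\mathcal{E}$ is a finite-dimensional real inner product space. An embedded ambient structure $(M,g,\mathcal{E})$ consists of a Riemannian manifold $M$ differentiably embedded as a submanifold of $\mathcal{E}$ (so $T_xM\subset\mathcal{E}$ and vector fields are $\mathcal{E}$-valued functions) and a metric operator: a smooth map $g:M\to L(\mathcal{E},\mathcal{E})$ with each $g_x$ (self-adjoint) positive-definite and $\langle\xi,g_x\eta\rangle_{\mathcal{E}}$ equal to the Riemannian inner product of $\xi,\eta\in T_xM$. $\Pi_{g,x}$ is the projection of $\mathcal{E}$ onto $T_xM$ orthogonal for $\langle\cdot,g_x\cdot\rangle_{\mathcal{E}}$; $\Pi_g:M\to L(\mathcal{E},\mathcal{E})$ is smooth. $D_\xi$ denotes the directional derivative of vector- or operator-valued functions on $M$. *)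

theory Defs
  imports "HOL-Analysis.Analysis"
begin

text \<open>
  Everything takes place inside a finite-dimensional real inner product space, the type
  \<open>'a::euclidean_space\<close>. ``Smooth'' means \<open>C\<^sup>\<infinity>\<close>. Functions on a subset \<open>M\<close> are total
  functions whose values outside \<open>M\<close> are never used.
\<close>

primrec Ck_on ::
  "nat \<Rightarrow> 'a::real_normed_vector set \<Rightarrow> ('a \<Rightarrow> 'b::real_normed_vector) \<Rightarrow> bool" where
  "Ck_on 0 S f \<longleftrightarrow> continuous_on S f"
| "Ck_on (Suc k) S f \<longleftrightarrow>
     (\<forall>x\<in>S. f differentiable (at x)) \<and>
     (\<forall>v. Ck_on k S (\<lambda>x. frechet_derivative f (at x) v))"

text \<open>
  For open \<open>S\<close> in a finite-dimensional space, continuity of all directional derivatives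
  \<open>x \<mapsto> Df(x) v\<close> amounts to continuity of \<open>Df\<close>, so \<open>Ck_on k\<close> is the usual class \<open>C\<^sup>k\<close>.
\<close>

definition smooth_on :: "'a::real_normed_vector set \<Rightarrow> ('a \<Rightarrow> 'b::real_normed_vector) \<Rightarrow> bool" where
  "smooth_on S f \<longleftrightarrow> (\<forall>k. Ck_on k S f)"

definition smooth_submanifold :: "nat \<Rightarrow> 'a::euclidean_space set \<Rightarrow> bool" where
  "smooth_submanifold d M \<longleftrightarrow>
     (\<forall>x\<in>M. \<exists>U V (\<phi> :: 'a \<Rightarrow> 'a) (\<psi> :: 'a \<Rightarrow> 'a) S. open U \<and> x \<in> U \<and> open V \<and>
        homeomorphism U V \<phi> \<psi> \<and> smooth_on U \<phi> \<and> smooth_on V \<psi> \<and>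
        subspace S \<and> dim S = d \<and> \<phi> ` (U \<inter> M) = V \<inter> S)"

definition smooth_map :: "'a::euclidean_space set \<Rightarrow> ('a \<Rightarrow> 'b::real_normed_vector) \<Rightarrow> bool" where
  "smooth_map M f \<longleftrightarrow>
     (\<forall>x\<in>M. \<exists>U F. open U \<and> x \<in> U \<and> smooth_on U F \<and> (\<forall>y\<in>U \<inter> M. F y = f y))"

definition curve_through :: "'a::euclidean_space set \<Rightarrow> 'a \<Rightarrow> 'a \<Rightarrow> (real \<Rightarrow> 'a) \<Rightarrow> bool" where
  "curve_through M x v \<gamma> \<longleftrightarrow>
     (\<exists>\<epsilon>>0. smooth_on {-\<epsilon><..<\<epsilon>} \<gamma> \<and> \<gamma> ` {-\<epsilon><..<\<epsilon>} \<subseteq> M) \<and>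
     \<gamma> 0 = x \<and> (\<gamma> has_vector_derivative v) (at 0)"

definition tangent_space :: "'a::euclidean_space set \<Rightarrow> 'a \<Rightarrow> 'a set" where
  "tangent_space M x = {v. \<exists>\<gamma>. curve_through M x v \<gamma>}"

text \<open>
  \<open>dir_deriv M f x v\<close> is \<open>(D\<^sub>v f)\<^sub>x\<close> for a tangent vector \<open>v\<close> at \<open>x\<close>: the common value
  at \<open>0\<close> of \<open>(f \<circ> \<gamma>)'\<close> over all curves \<open>\<gamma>\<close> in \<open>M\<close> through \<open>x\<close> with velocity \<open>v\<close>.
\<close>

definition dir_deriv ::
  "'a::euclidean_space set \<Rightarrow> ('a \<Rightarrow> 'b::real_normed_vector) \<Rightarrow> 'a \<Rightarrow> 'a \<Rightarrow> 'b" where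
  "dir_deriv M f x v =
     (THE w. \<forall>\<gamma>. curve_through M x v \<gamma> \<longrightarrow> ((\<lambda>t. f (\<gamma> t)) has_vector_derivative w) (at 0))"

definition smooth_vector_field :: "'a::euclidean_space set \<Rightarrow> ('a \<Rightarrow> 'a) \<Rightarrow> bool" where
  "smooth_vector_field M X \<longleftrightarrow> smooth_map M X \<and> (\<forall>x\<in>M. X x \<in> tangent_space M x)"

text \<open>
  The Lie bracket is the intrinsic one: the tangent vector that acts on smooth functions as
  the commutator of the derivations \<open>X\<close> and \<open>Y\<close>.
\<close>

definition lie_bracket ::
  "'a::euclidean_space set \<Rightarrow> ('a \<Rightarrow> 'a) \<Rightarrow> ('a \<Rightarrow> 'a) \<Rightarrow> 'a \<Rightarrow> 'a" where
  "lie_bracket M X Y x =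
     (THE v. v \<in> tangent_space M x \<and>
        (\<forall>f :: 'a \<Rightarrow> real. smooth_map M f \<longrightarrow>
           dir_deriv M f x v =
             dir_deriv M (\<lambda>y. dir_deriv M f y (Y y)) x (X x) -
             dir_deriv M (\<lambda>y. dir_deriv M f y (X y)) x (Y x)))"

definition riemannian_metric ::
  "'a::euclidean_space set \<Rightarrow> ('a \<Rightarrow> 'a \<Rightarrow> 'a \<Rightarrow> real) \<Rightarrow> bool" where
  "riemannian_metric M \<rho> \<longleftrightarrow>
     (\<forall>x\<in>M.
        (\<forall>u\<in>tangent_space M x. \<forall>v\<in>tangent_space M x. \<forall>w\<in>tangent_space M x. \<forall>a b.
           \<rho> x (a *\<^sub>R u + b *\<^sub>R v) w = a * \<rho> x u w + b * \<rho> x v w) \<and>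
        (\<forall>u\<in>tangent_space M x. \<forall>v\<in>tangent_space M x. \<rho> x u v = \<rho> x v u) \<and>
        (\<forall>u\<in>tangent_space M x. u \<noteq> 0 \<longrightarrow> \<rho> x u u > 0)) \<and>
     (\<forall>X Y. smooth_vector_field M X \<longrightarrow> smooth_vector_field M Y \<longrightarrow>
        smooth_map M (\<lambda>x. \<rho> x (X x) (Y x)))"

definition metric_operator ::
  "'a::euclidean_space set \<Rightarrow> ('a \<Rightarrow> 'a \<Rightarrow> 'a \<Rightarrow> real) \<Rightarrow> ('a \<Rightarrow> 'a \<Rightarrow>\<^sub>L 'a) \<Rightarrow> bool" where
  "metric_operator M \<rho> g \<longleftrightarrow> smooth_map M g \<and>
     (\<forall>x\<in>M.
        (\<forall>u v. blinfun_apply (g x) u \<bullet> v = u \<bullet> blinfun_apply (g x) v) \<and>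
        (\<forall>u. u \<noteq> 0 \<longrightarrow> u \<bullet> blinfun_apply (g x) u > 0) \<and>
        (\<forall>u\<in>tangent_space M x. \<forall>v\<in>tangent_space M x. u \<bullet> blinfun_apply (g x) v = \<rho> x u v))"

definition embedded_ambient_structure ::
  "'a::euclidean_space set \<Rightarrow> ('a \<Rightarrow> 'a \<Rightarrow> 'a \<Rightarrow> real) \<Rightarrow> ('a \<Rightarrow> 'a \<Rightarrow>\<^sub>L 'a) \<Rightarrow> bool" where
  "embedded_ambient_structure M \<rho> g \<longleftrightarrow>
     (\<exists>d. smooth_submanifold d M) \<and> riemannian_metric M \<rho> \<and> metric_operator M \<rho> g"

definition metric_proj ::
  "'a::euclidean_space set \<Rightarrow> ('a \<Rightarrow> 'a \<Rightarrow>\<^sub>L 'a) \<Rightarrow> 'a \<Rightarrow> 'a \<Rightarrow>\<^sub>L 'a" where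
  "metric_proj M g x = Blinfun (\<lambda>v. THE w. w \<in> tangent_space M x \<and>
     (\<forall>u\<in>tangent_space M x. u \<bullet> blinfun_apply (g x) (v - w) = 0))"

definition proj_field ::
  "'a::euclidean_space set \<Rightarrow> ('a \<Rightarrow> 'a \<Rightarrow>\<^sub>L 'a) \<Rightarrow> 'a \<Rightarrow> 'a \<Rightarrow> 'a" where
  "proj_field M g v y = blinfun_apply (metric_proj M g y) v"

end

theory Submission
  imports Defs
begin

text \<open>
  Write \<open>\<Pi>\<close> for the field of projections. The idea is to differentiate the identity \<open>\<Pi>\<^sub>y u = u\<close>, valid for
  tangent vectors \<open>u\<close> at \<open>y\<close>, along a coordinate line. Let \<open>\<psi>\<close> be the inverse of a slice chart at
  \<open>x\<close>, so that \<open>\<psi>\<close> maps an open part of a subspace \<open>S\<close> onto an open part of \<open>M\<close>, and let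
  \<open>\<xi> = D\<psi>(z) r\<close> and \<open>\<eta> = D\<psi>(z) s\<close> with \<open>r, s \<in> S\<close> and \<open>\<psi> z = x\<close>. For small \<open>t\<close> the vector
  \<open>D\<psi>(z + t r) s\<close> is tangent to \<open>M\<close> at \<open>\<psi>(z + t r)\<close> and hence fixed by the projection there. The
  derivative of this equation at \<open>t = 0\<close> is
  
    \<open>(D\<^sub>\<xi> \<Pi>) \<eta> + \<Pi>\<^sub>x w = w\<close>, with \<open>w = D\<^sup>2\<psi>(z)(r, s)\<close>.
  
  So \<open>(D\<^sub>\<xi> \<Pi>) \<eta> = w - \<Pi>\<^sub>x w\<close>. The right-hand side is symmetric in \<open>\<xi>\<close> and \<open>\<eta>\<close> because second
  derivatives are, and \<open>\<Pi>\<^sub>x\<close> annihilates it because \<open>\<Pi>\<^sub>x\<close> is idempotent; since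
  \<open>D\<^sub>\<xi> p\<^sub>\<eta> = (D\<^sub>\<xi> \<Pi>) \<eta>\<close>, this gives the first and the last of the three identities
  (\<open>derivative_fixing_tangent_vectors\<close>). For the bracket, the intrinsic commutator of two tangent fields is
  computed from an ambient extension \<open>F\<close> of the test function: the second derivatives of \<open>F\<close> cancel,
  and what remains is \<open>DF(x) (D\<^sub>X Y - D\<^sub>Y X)\<close> (\<open>lie_bracket_eq\<close>). For \<open>p\<^sub>\<xi>\<close> and \<open>p\<^sub>\<eta>\<close> the
  difference \<open>D\<^sub>X Y - D\<^sub>Y X\<close> is \<open>(D\<^sub>\<xi> \<Pi>) \<eta> - (D\<^sub>\<eta> \<Pi>) \<xi> = 0\<close>.
  
  The analytic point is that \<open>\<Pi>\<close> is differentiable at all (\<open>metric_proj_differentiable\<close>). In the chart,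
  the conditions ``tangent'' and ``orthogonal to the tangent space'' form a linear system for \<open>\<Pi>\<^sub>y v\<close>
  whose coefficients depend differentiably on \<open>y\<close> and which is injective at \<open>x\<close>; a solution of such a
  system is differentiable at \<open>x\<close> (\<open>linear_solution_differentiable\<close>). Differentiability is always
  understood at a point within \<open>M\<close>, which suffices to compute derivatives along curves in \<open>M\<close> and makes
  it unnecessary to extend \<open>\<Pi>\<close> to the ambient space.
\<close>

section \<open>Second derivatives\<close>

text \<open>
  The Frechet derivative as a point of the normed space of operators, so that it can itself be
  differentiated as a function of the base point.
\<close>

definition blinfun_deriv where
  "blinfun_deriv f y = Blinfun (frechet_derivative f (at y))"

text \<open>
  Fix \<open>t\<close> and apply the mean value inequality on \<open>[0, t]\<close> to
  \<open>s \<mapsto> F(x + s u + t v) - F(x + s u) - s t G'(v) u\<close>. Its derivative is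
  \<open>(G(x + s u + t v) - G(x + s u)) u - t G'(v) u\<close>, which is \<open>o(t)\<close> because \<open>G\<close> is differentiable
  at \<open>x\<close>.
\<close>

lemma second_difference_estimate:
  fixes F :: "'a::real_normed_vector \<Rightarrow> 'b::real_normed_vector"
    and G :: "'a \<Rightarrow> 'a \<Rightarrow>\<^sub>L 'b"
  assumes U: "open U" "x \<in> U"
    and F: "\<And>y. y \<in> U \<Longrightarrow> (F has_derivative blinfun_apply (G y)) (at y)"
    and G: "(G has_derivative G') (at x)"
    and e: "0 < e"
  shows "\<exists>d>0. \<forall>t. 0 < t \<and> t < d \<longrightarrow>
    norm (F (x + t *\<^sub>R u + t *\<^sub>R v) - F (x + t *\<^sub>R u) - F (x + t *\<^sub>R v) + F x
            - (t * t) *\<^sub>R blinfun_apply (G' v) u)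
      \<le> e * (2 * norm u + norm v) * norm u * (t * t)"
proof -
  interpret G': bounded_linear G' by (rule has_derivative_bounded_linear[OF G])
  obtain r where r: "r > 0" "ball x r \<subseteq> U"
    using U openE by blast
  obtain d0 where d0: "d0 > 0"
    "\<And>y. norm (y - x) < d0 \<Longrightarrow> norm (G y - G x - G' (y - x)) \<le> e * norm (y - x)"
    using G e unfolding has_derivative_at_alt by blast
  \<comment> \<open>for \<open>t < d\<close> both evaluation points stay in \<open>U\<close> and in the range of the little-o estimate\<close>
  define m where "m = min r d0"
  have m: "m > 0" using r d0 m_def by simp
  define d where "d = m / (norm u + norm v + 1)"
  have pos: "norm u + norm v + 1 > 0"
    by (smt (verit) norm_ge_zero)
  have d: "d > 0" using m pos d_def by simp
  have small: "norm (s *\<^sub>R u + t *\<^sub>R v) < m"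
    if "0 \<le> s" "s \<le> t" "t < d" "0 < t" for s t
  proof -
    have "norm (s *\<^sub>R u + t *\<^sub>R v) \<le> s * norm u + t * norm v"
      using norm_triangle_ineq[of "s *\<^sub>R u" "t *\<^sub>R v"] that by simp
    also have "\<dots> \<le> t * norm u + t * norm v"
      using that by (simp add: mult_right_mono)
    also have "\<dots> \<le> t * (norm u + norm v + 1)"
      using that by (simp add: algebra_simps)
    also have "\<dots> < m"
      using that pos unfolding d_def by (simp add: pos_less_divide_eq)
    finally show ?thesis .
  qed
  have small0: "norm (s *\<^sub>R u) < m"
    if "0 \<le> s" "s \<le> t" "t < d" "0 < t" for s t
  proof -
    have "norm (s *\<^sub>R u) \<le> t * norm u"
      using that by (simp add: mult_right_mono)
    also have "\<dots> \<le> t * (norm u + norm v + 1)"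
      using that by (simp add: mult_left_mono)
    also have "\<dots> < m"
      using that pos unfolding d_def by (simp add: pos_less_divide_eq)
    finally show ?thesis .
  qed
  show ?thesis
  proof (intro exI[of _ d] conjI allI impI d)
    fix t assume t: "0 < t \<and> t < d"
    define h where "h s = F (x + (s *\<^sub>R u + t *\<^sub>R v)) - F (x + s *\<^sub>R u)
       - (s * t) *\<^sub>R blinfun_apply (G' v) u" for s
    define h' where "h' s = blinfun_apply (G (x + (s *\<^sub>R u + t *\<^sub>R v))) u
        - blinfun_apply (G (x + s *\<^sub>R u)) u - t *\<^sub>R blinfun_apply (G' v) u" for s
    have der: "(h has_derivative (\<lambda>k. k *\<^sub>R h' s)) (at s within {0..t})" if s: "s \<in> {0..t}" for s
    proof -
      have 1: "x + (s *\<^sub>R u + t *\<^sub>R v) \<in> U" and 2: "x + s *\<^sub>R u \<in> U"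
        using small[of s t] small0[of s t] s t r unfolding m_def
        by (auto intro!: subsetD[OF r(2)] simp: dist_norm add.commute norm_minus_commute)
      have a: "((\<lambda>s. x + (s *\<^sub>R u + t *\<^sub>R v)) has_derivative (\<lambda>k. k *\<^sub>R u)) (at s within {0..t})"
        by (auto intro!: derivative_eq_intros)
      have b: "((\<lambda>s. x + s *\<^sub>R u) has_derivative (\<lambda>k. k *\<^sub>R u)) (at s within {0..t})"
        by (auto intro!: derivative_eq_intros)
      show ?thesis
        unfolding h_def h'_def
        by (rule derivative_eq_intros has_derivative_compose[OF a F[OF 1]]
             has_derivative_compose[OF b F[OF 2]] refl)+
           (auto simp: blinfun.scaleR_right algebra_simps)
    qed
    have bound: "norm (h' s) \<le> e * (2 * norm u + norm v) * norm u * t" if s: "s \<in> {0..t}" for s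
    proof -
      let ?p = "s *\<^sub>R u + t *\<^sub>R v" and ?q = "s *\<^sub>R u"
      have 1: "norm (G (x + ?p) - G x - G' ?p) \<le> e * norm ?p"
        using d0(2)[of "x + ?p"] small[of s t] s t unfolding m_def by simp
      have 2: "norm (G (x + ?q) - G x - G' ?q) \<le> e * norm ?q"
        using d0(2)[of "x + ?q"] small0[of s t] s t unfolding m_def by simp
      have 3: "h' s = blinfun_apply ((G (x + ?p) - G x - G' ?p) - (G (x + ?q) - G x - G' ?q)) u"
        unfolding h'_def
        by (simp add: blinfun.bilinear_simps G'.add G'.scaleR algebra_simps)
      have "norm (h' s) \<le> norm ((G (x + ?p) - G x - G' ?p) - (G (x + ?q) - G x - G' ?q)) * norm u"
        unfolding 3 by (rule norm_blinfun)
      also have "\<dots> \<le> (e * norm ?p + e * norm ?q) * norm u"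
        by (intro mult_right_mono norm_ge_zero order.trans[OF norm_triangle_ineq4] add_mono 1 2)
      also have "\<dots> \<le> (e * (t * norm u + t * norm v) + e * (t * norm u)) * norm u"
        using s t e
        by (intro mult_right_mono norm_ge_zero add_mono mult_left_mono
             order.trans[OF norm_triangle_ineq])
           (auto intro: mult_right_mono)
      also have "\<dots> = e * (2 * norm u + norm v) * norm u * t"
        by (simp add: algebra_simps)
      finally show ?thesis .
    qed
    have "norm (h t - h 0) \<le> (e * (2 * norm u + norm v) * norm u * t) * norm (t - 0)"
    proof (rule differentiable_bound[of "{0..t}" h "\<lambda>s k. k *\<^sub>R h' s"])
      show "onorm (\<lambda>k. k *\<^sub>R h' s) \<le> e * (2 * norm u + norm v) * norm u * t"
        if "s \<in> {0..t}" for s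
        using bound[OF that]
        by (intro onorm_le) (metis abs_ge_zero mult.commute mult_left_mono norm_scaleR real_norm_def)
    qed (use der t in auto)
    then show "norm (F (x + t *\<^sub>R u + t *\<^sub>R v) - F (x + t *\<^sub>R u) - F (x + t *\<^sub>R v) + F x
            - (t * t) *\<^sub>R blinfun_apply (G' v) u)
      \<le> e * (2 * norm u + norm v) * norm u * (t * t)"
      using t unfolding h_def by (simp add: algebra_simps)
  qed
qed

text \<open>
  The second difference is symmetric in \<open>u\<close> and \<open>v\<close>, and by the estimate above it determines
  \<open>G'(v) u\<close> and \<open>G'(u) v\<close> up to an arbitrarily small multiple of \<open>t\<^sup>2\<close>.
\<close>

lemma second_derivative_symmetric:
  fixes F :: "'a::real_normed_vector \<Rightarrow> 'b::real_normed_vector"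
    and G :: "'a \<Rightarrow> 'a \<Rightarrow>\<^sub>L 'b"
  assumes U: "open U" "x \<in> U"
    and F: "\<And>y. y \<in> U \<Longrightarrow> (F has_derivative blinfun_apply (G y)) (at y)"
    and G: "(G has_derivative G') (at x)"
  shows "blinfun_apply (G' u) v = blinfun_apply (G' v) u"
proof -
  define A where "A = (2 * norm u + norm v) * norm u + (2 * norm v + norm u) * norm v"
  have A: "A \<ge> 0" unfolding A_def by simp
  have key: "norm (blinfun_apply (G' u) v - blinfun_apply (G' v) u) \<le> e * A" if e: "e > 0" for e
  proof -
    let ?\<Delta> = "\<lambda>t. F (x + t *\<^sub>R u + t *\<^sub>R v) - F (x + t *\<^sub>R u) - F (x + t *\<^sub>R v) + F x"
    obtain d1 where d1: "d1 > 0" "\<And>t. 0 < t \<Longrightarrow> t < d1 \<Longrightarrow>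
        norm (?\<Delta> t - (t * t) *\<^sub>R blinfun_apply (G' v) u) \<le> e * (2 * norm u + norm v) * norm u * (t * t)"
      using second_difference_estimate[OF U F G e, of u v] by blast
    obtain d2 where d2: "d2 > 0" "\<And>t. 0 < t \<Longrightarrow> t < d2 \<Longrightarrow>
        norm (F (x + t *\<^sub>R v + t *\<^sub>R u) - F (x + t *\<^sub>R v) - F (x + t *\<^sub>R u) + F x
          - (t * t) *\<^sub>R blinfun_apply (G' u) v) \<le> e * (2 * norm v + norm u) * norm v * (t * t)"
      using second_difference_estimate[OF U F G e, of v u] by blast
    define t where "t = min d1 d2 / 2"
    have t: "0 < t" "t < d1" "t < d2" using d1 d2 unfolding t_def by auto
    have 1: "norm (?\<Delta> t - (t * t) *\<^sub>R blinfun_apply (G' v) u) \<le> e * (2 * norm u + norm v) * norm u * (t * t)"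
      using d1 t by blast
    have 2: "norm (?\<Delta> t - (t * t) *\<^sub>R blinfun_apply (G' u) v) \<le> e * (2 * norm v + norm u) * norm v * (t * t)"
      using d2(2)[OF t(1,3)] by (simp add: algebra_simps)
    have "(t * t) * norm (blinfun_apply (G' u) v - blinfun_apply (G' v) u)
        = norm ((?\<Delta> t - (t * t) *\<^sub>R blinfun_apply (G' v) u) - (?\<Delta> t - (t * t) *\<^sub>R blinfun_apply (G' u) v))"
      using t by (simp flip: scaleR_diff_right)
    also have "\<dots> \<le> (t * t) * (e * A)"
      using norm_triangle_ineq4 1 2 unfolding A_def
      by (smt (verit, ccfv_SIG) distrib_left mult.assoc mult.commute)
    finally show ?thesis using t by simp
  qed
  have "norm (blinfun_apply (G' u) v - blinfun_apply (G' v) u) \<le> 0"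
  proof (rule field_le_epsilon)
    fix e :: real assume "e > 0"
    \<comment> \<open>\<open>A + 1\<close> instead of \<open>A\<close>, which vanishes for \<open>u = v = 0\<close>\<close>
    then have "norm (blinfun_apply (G' u) v - blinfun_apply (G' v) u) \<le> e / (A + 1) * A"
      using A by (intro key) simp
    also have "\<dots> \<le> e" using A \<open>e > 0\<close> by (simp add: divide_simps)
    finally show "norm (blinfun_apply (G' u) v - blinfun_apply (G' v) u) \<le> 0 + e" by simp
  qed
  then show ?thesis by simp
qed

lemma blinfun_differentiable_componentwise:
  fixes F :: "'n::real_normed_vector \<Rightarrow> 'a::euclidean_space \<Rightarrow>\<^sub>L 'b::real_normed_vector"
  assumes "\<And>b. b \<in> Basis \<Longrightarrow> (\<lambda>y. blinfun_apply (F y) b) differentiable (at x within M)"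
  shows "F differentiable (at x within M)"
proof -
  define E :: "'a \<Rightarrow> 'b \<Rightarrow> 'a \<Rightarrow>\<^sub>L 'b" where
    "E b w = blinfun_scaleR_left w o\<^sub>L blinfun_inner_left b" for b w
  have E: "bounded_linear (E b)" for b
    unfolding E_def
    by (intro bounded_linear_intros bounded_linear_compose[OF bounded_bilinear.bounded_linear_left[OF bounded_bilinear_blinfun_compose]])
  \<comment> \<open>an operator is the sum of the rank-one operators given by its values on a basis\<close>
  have "F y = (\<Sum>b\<in>Basis. E b (blinfun_apply (F y) b))" for y
    by (intro blinfun_euclidean_eqI)
       (simp add: E_def blinfun.sum_left inner_Basis if_distrib[of "\<lambda>c. c *\<^sub>R _"] cong: if_cong)
  then have F: "F = (\<lambda>y. \<Sum>b\<in>Basis. E b (blinfun_apply (F y) b))"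
    by blast
  show ?thesis
    by (subst F, intro differentiable_sum ballI finite_Basis)
       (metis E assms bounded_linear.has_derivative differentiable_def)
qed

lemma smooth_on_has_derivative:
  fixes f :: "'a::real_normed_vector \<Rightarrow> 'b::real_normed_vector"
  assumes "smooth_on U f" "y \<in> U"
  shows "(f has_derivative blinfun_apply (blinfun_deriv f y)) (at y)"
proof -
  have "Ck_on (Suc 0) U f" using assms unfolding smooth_on_def by blast
  then have "f differentiable (at y)" using assms by simp
  then have f: "(f has_derivative frechet_derivative f (at y)) (at y)"
    using frechet_derivative_works by blast
  then show ?thesis
    by (simp add: blinfun_deriv_def bounded_linear_Blinfun_apply has_derivative_bounded_linear)
qed

lemma has_derivative_blinfun_deriv:
  assumes "(f has_derivative f') (at y)"
  shows "blinfun_apply (blinfun_deriv f y) = f'"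
  using frechet_derivative_at[OF assms] has_derivative_bounded_linear[OF assms]
  by (simp add: blinfun_deriv_def bounded_linear_Blinfun_apply)

lemma smooth_on_blinfun_deriv_differentiable:
  fixes f :: "'a::euclidean_space \<Rightarrow> 'b::real_normed_vector"
  assumes "open U" "smooth_on U f" "y \<in> U"
  shows "blinfun_deriv f differentiable (at y)"
proof (rule blinfun_differentiable_componentwise)
  fix b :: 'a
  have "Ck_on (Suc (Suc 0)) U f" using assms unfolding smooth_on_def by blast
  then obtain D where D: "((\<lambda>z. frechet_derivative f (at z) b) has_derivative D) (at y)"
    using assms(3) unfolding Ck_on.simps differentiable_def by blast
  have "((\<lambda>z. blinfun_apply (blinfun_deriv f z) b) has_derivative D) (at y)"
    by (rule has_derivative_transform_within_open[OF D \<open>open U\<close> \<open>y \<in> U\<close>])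
       (metis assms(2) has_derivative_blinfun_deriv frechet_derivative_at smooth_on_has_derivative)
  then show "(\<lambda>z. blinfun_apply (blinfun_deriv f z) b) differentiable (at y)"
    by (auto simp: differentiable_def)
qed

section \<open>Differentiability of solutions of linear equations\<close>

text \<open>
  A left inverse of the coefficient operator at the one point \<open>x\<close> is enough: with \<open>C\<close> such an inverse,
  the equation becomes
  \<open>p y - p x = C (R y - R x) - C (L y - L x) (p y)\<close>. First, since \<open>C (L y - L x)\<close> is small, the last term
  can be absorbed and \<open>p\<close> is continuous at \<open>x\<close>. Then \<open>(L y - L x) (p y)\<close> is a product of a
  differentiable factor vanishing at \<open>x\<close> and a continuous one, hence differentiable at \<open>x\<close>, and so is
  \<open>p\<close>.
\<close>

lemma linear_solution_differentiable:
  fixes L :: "'n::real_normed_vector \<Rightarrow> 'a::real_normed_vector \<Rightarrow>\<^sub>L 'b::real_normed_vector"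
  assumes L: "L differentiable (at x within M)"
    and R: "R differentiable (at x within M)"
    and sol: "\<And>y. y \<in> M \<Longrightarrow> blinfun_apply (L y) (p y) = R y" and x: "x \<in> M"
    and inv: "C o\<^sub>L L x = id_blinfun"
  shows "p differentiable (at x within M)"
proof -
  obtain L' where L': "(L has_derivative L') (at x within M)" using L differentiable_def by blast
  interpret L': bounded_linear L' by (rule has_derivative_bounded_linear[OF L'])
  let ?F = "at x within M"
  have CL: "blinfun_apply C (blinfun_apply (L x) v) = v" for v
    by (metis inv blinfun_apply_blinfun_compose blinfun_apply_id_blinfun)
  have step: "p y = p x + blinfun_apply C (R y - R x) - blinfun_apply C (blinfun_apply (L y - L x) (p y))"
    if "y \<in> M" for y
    using sol[OF that] sol[OF x] CL[of "p y"] CL[of "p x"]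
    by (simp add: blinfun.bilinear_simps)
  have Lt: "(L \<longlongrightarrow> L x) ?F" and Rt: "(R \<longlongrightarrow> R x) ?F"
    using L R differentiable_imp_continuous_within unfolding continuous_within by auto
  have inM: "\<forall>\<^sub>F y in ?F. y \<in> M" by (simp add: eventually_at_filter)
  have pt: "(p \<longlongrightarrow> p x) ?F"
  proof (rule Lim_null_comparison[THEN LIM_zero_cancel])
    have "((\<lambda>y. norm C * norm (L y - L x)) \<longlongrightarrow> norm C * 0) ?F"
      by (intro tendsto_mult tendsto_const tendsto_norm_zero LIM_zero Lt)
    then have "\<forall>\<^sub>F y in ?F. norm C * norm (L y - L x) < 1 / 2"
      by (rule order_tendstoD) simp
    with inM show "\<forall>\<^sub>F y in ?F. norm (p y - p x) \<le> 2 * (norm C * (norm (R y - R x) + norm (L y - L x) * norm (p x)))"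
    proof eventually_elim
      case (elim y)
      have "p y - p x = blinfun_apply C (R y - R x) - blinfun_apply C (blinfun_apply (L y - L x) (p x))
         - blinfun_apply C (blinfun_apply (L y - L x) (p y - p x))"
        using step[OF elim(1)] by (simp add: blinfun.bilinear_simps algebra_simps)
      also have "norm \<dots> \<le> norm C * norm (R y - R x) + norm C * (norm (L y - L x) * norm (p x))
          + norm C * (norm (L y - L x) * norm (p y - p x))"
        by (intro order.trans[OF norm_triangle_ineq4] add_mono order.trans[OF norm_blinfun]
              mult_left_mono norm_blinfun norm_ge_zero order.refl)
      also have "norm C * (norm (L y - L x) * norm (p y - p x)) \<le> 1 / 2 * norm (p y - p x)"
        using elim(2) by (simp only: mult.assoc[symmetric]) (intro mult_right_mono, auto)
      finally show ?case by (simp add: algebra_simps)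
    qed
    have "((\<lambda>y. 2 * (norm C * (norm (R y - R x) + norm (L y - L x) * norm (p x)))) \<longlongrightarrow>
        2 * (norm C * (0 + 0 * norm (p x)))) ?F"
      by (intro tendsto_mult tendsto_add tendsto_const tendsto_norm_zero LIM_zero Lt Rt)
    then show "((\<lambda>y. 2 * (norm C * (norm (R y - R x) + norm (L y - L x) * norm (p x)))) \<longlongrightarrow> 0) ?F"
      by simp
  qed
  have prod: "((\<lambda>y. blinfun_apply (L y - L x) (p y)) has_derivative (\<lambda>h. blinfun_apply (L' h) (p x))) ?F"
    unfolding has_derivative_within
  proof
    show "bounded_linear (\<lambda>h. blinfun_apply (L' h) (p x))"
      by (rule bounded_linear_compose[OF blinfun.bounded_linear_left L'.bounded_linear_axioms])
    let ?q = "\<lambda>y. (1 / norm (y - x)) *\<^sub>R (L y - (L x + L' (y - x)))"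
    have q: "(?q \<longlongrightarrow> 0) ?F" using L' unfolding has_derivative_within by blast
    obtain K where K: "\<And>h. norm (L' h) \<le> norm h * K" using L'.bounded by blast
    have "((\<lambda>y. norm (blinfun_apply (?q y) (p y)) + \<bar>K\<bar> * norm (p y - p x)) \<longlongrightarrow> norm (blinfun_apply (0 :: 'a \<Rightarrow>\<^sub>L 'b) (p x)) + \<bar>K\<bar> * 0) ?F"
      by (intro tendsto_add tendsto_mult tendsto_const tendsto_norm[OF blinfun.tendsto[OF q pt]]
            tendsto_norm_zero LIM_zero pt)
    then have lim: "((\<lambda>y. norm (blinfun_apply (?q y) (p y)) + \<bar>K\<bar> * norm (p y - p x)) \<longlongrightarrow> 0) ?F"
      by simp
    show "((\<lambda>y. (1 / norm (y - x)) *\<^sub>R (blinfun_apply (L y - L x) (p y) -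
        (blinfun_apply (L x - L x) (p x) + blinfun_apply (L' (y - x)) (p x)))) \<longlongrightarrow> 0) ?F"
    proof (rule Lim_null_comparison[OF always_eventually lim], rule allI)
      fix y
      have eq: "(1 / norm (y - x)) *\<^sub>R (blinfun_apply (L y - L x) (p y) -
        (blinfun_apply (L x - L x) (p x) + blinfun_apply (L' (y - x)) (p x)))
        = blinfun_apply (?q y) (p y) + (1 / norm (y - x)) *\<^sub>R blinfun_apply (L' (y - x)) (p y - p x)"
        by (simp add: blinfun.bilinear_simps algebra_simps)
      have "norm ((1 / norm (y - x)) *\<^sub>R blinfun_apply (L' (y - x)) (p y - p x)) \<le> \<bar>K\<bar> * norm (p y - p x)"
      proof (cases "y = x")
        case False
        have "norm (blinfun_apply (L' (y - x)) (p y - p x)) \<le> (norm (y - x) * K) * norm (p y - p x)"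
          by (intro order.trans[OF norm_blinfun] mult_right_mono K norm_ge_zero)
        also have "\<dots> \<le> (norm (y - x) * \<bar>K\<bar>) * norm (p y - p x)"
          by (intro mult_right_mono mult_left_mono) auto
        finally show ?thesis using False by (simp add: divide_simps mult_ac)
      qed simp
      then show "norm ((1 / norm (y - x)) *\<^sub>R (blinfun_apply (L y - L x) (p y) -
        (blinfun_apply (L x - L x) (p x) + blinfun_apply (L' (y - x)) (p x))))
        \<le> norm (blinfun_apply (?q y) (p y)) + \<bar>K\<bar> * norm (p y - p x)"
        unfolding eq using norm_triangle_ineq by (smt (verit))
    qed
  qed
  obtain R' where R': "(R has_derivative R') ?F" using R differentiable_def by blast
  have "((\<lambda>y. p x + blinfun_apply C (R y - R x) - blinfun_apply C (blinfun_apply (L y - L x) (p y)))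
      has_derivative (\<lambda>h. 0 + blinfun_apply C (R' h - 0) - blinfun_apply C (blinfun_apply (L' h) (p x)))) ?F"
    by (intro has_derivative_add has_derivative_diff has_derivative_const R' prod
          bounded_linear.has_derivative[OF blinfun.bounded_linear_right])
  then have "(p has_derivative (\<lambda>h. 0 + blinfun_apply C (R' h - 0) - blinfun_apply C (blinfun_apply (L' h) (p x)))) ?F"
    by (rule has_derivative_transform[OF x step, rotated])
  then show ?thesis
    unfolding differentiable_def by blast
qed

section \<open>Smooth maps and derivatives along a submanifold\<close>

lemma Ck_on_cong:
  assumes "open S" "\<And>y. y \<in> S \<Longrightarrow> f y = g y" "Ck_on k S f"
  shows "Ck_on k S g"
  using assms(2,3)
proof (induction k arbitrary: f g)
  case 0
  then show ?case by (simp cong: continuous_on_cong)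
next
  case (Suc k)
  have d: "g differentiable (at y)" "frechet_derivative f (at y) = frechet_derivative g (at y)"
    if "y \<in> S" for y
  proof -
    have f: "(f has_derivative frechet_derivative f (at y)) (at y)"
      using Suc.prems that frechet_derivative_works by auto
    have "(g has_derivative frechet_derivative f (at y)) (at y)"
      by (rule has_derivative_transform_within_open[OF f \<open>open S\<close> that Suc.prems(1)])
    then show "g differentiable (at y)" "frechet_derivative f (at y) = frechet_derivative g (at y)"
      by (auto simp: differentiable_def frechet_derivative_at)
  qed
  then show ?case
    using Suc.prems Suc.IH[of "\<lambda>y. frechet_derivative f (at y) v" "\<lambda>y. frechet_derivative g (at y) v" for v]
    by simp
qed

text \<open>
  The chain rule for \<open>C\<^sup>k\<close> maps in the only case required, where the inner map is affine on the line:
  then all derivatives have the form \<open>r h(a + t s)\<close> again, and the factor \<open>r\<close> makes the induction close.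
\<close>

lemma Ck_on_along_line:
  fixes f :: "'a::real_normed_vector \<Rightarrow> 'b::real_normed_vector" and I :: "real set"
  assumes I: "open I" and V: "\<And>t. t \<in> I \<Longrightarrow> a + t *\<^sub>R s \<in> V" and f: "Ck_on k V f"
  shows "Ck_on k I (\<lambda>t. r *\<^sub>R f (a + t *\<^sub>R s))"
  using f
proof (induction k arbitrary: f r)
  case 0
  have "continuous_on I (\<lambda>t. f (a + t *\<^sub>R s))"
    by (rule continuous_on_compose2[of V f]) (use 0 V in \<open>auto intro!: continuous_intros\<close>)
  then show ?case by (simp add: continuous_on_scaleR)
next
  case (Suc k)
  have der: "((\<lambda>t. r *\<^sub>R f (a + t *\<^sub>R s)) has_derivative
      (\<lambda>h. (h * r) *\<^sub>R frechet_derivative f (at (a + t *\<^sub>R s)) s)) (at t)" if "t \<in> I" for t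
  proof -
    have f: "(f has_derivative frechet_derivative f (at (a + t *\<^sub>R s))) (at (a + t *\<^sub>R s))"
      using Suc.prems V[OF that] frechet_derivative_works by auto
    have l: "((\<lambda>t. a + t *\<^sub>R s) has_derivative (\<lambda>h. h *\<^sub>R s)) (at t)"
      by (auto intro!: derivative_eq_intros)
    show ?thesis
      using has_derivative_scaleR_right[OF has_derivative_compose[OF l f], of r]
      by (simp add: linear_simps(5)[OF has_derivative_bounded_linear[OF f]] mult.commute)
  qed
  have "Ck_on k I (\<lambda>t. frechet_derivative (\<lambda>t. r *\<^sub>R f (a + t *\<^sub>R s)) (at t) h)" for h
  proof (rule Ck_on_cong[OF I])
    show "Ck_on k I (\<lambda>t. (h * r) *\<^sub>R frechet_derivative f (at (a + t *\<^sub>R s)) s)"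
      using Suc.IH[of "\<lambda>y. frechet_derivative f (at y) s"] Suc.prems by simp
  qed (simp add: frechet_derivative_at[OF der, symmetric])
  then show ?case using der by (auto simp: differentiable_def)
qed

lemma Ck_on_const: "Ck_on k S (\<lambda>_. c)"
  by (induction k arbitrary: c) simp_all

lemma smooth_on_bounded_linear:
  assumes "bounded_linear f"
  shows "smooth_on S f"
  unfolding smooth_on_def
proof
  fix k show "Ck_on k S f"
  proof (cases k)
    case 0
    then show ?thesis using assms by (simp add: linear_continuous_on)
  next
    case (Suc n)
    have "frechet_derivative f (at y) = f" for y
      using frechet_derivative_at[OF bounded_linear_imp_has_derivative[OF assms, of "at y"]] by simp
    then show ?thesis
      using Suc assms by (simp add: Ck_on_const bounded_linear_imp_differentiable)
  qed
qed

text \<open>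
  A derivative within \<open>M\<close> computes every derivative along curves in \<open>M\<close>. Only its values on
  tangent vectors are determined by \<open>f\<close>.
\<close>

lemma dir_deriv_eq:
  assumes f: "(f has_derivative f') (at x within M)" and v: "v \<in> tangent_space M x"
  shows "dir_deriv M f x v = f' v"
proof -
  have der: "((\<lambda>t. f (\<gamma> t)) has_vector_derivative f' v) (at 0)" if c: "curve_through M x v \<gamma>" for \<gamma>
  proof -
    obtain e where e: "e > 0" "\<gamma> ` {-e<..<e} \<subseteq> M" "\<gamma> 0 = x" "(\<gamma> has_vector_derivative v) (at 0)"
      using c unfolding curve_through_def by blast
    have g: "(\<gamma> has_derivative (\<lambda>t. t *\<^sub>R v)) (at 0 within {-e<..<e})"
      using e(4) unfolding has_vector_derivative_def by (rule has_derivative_at_withinI)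
    have "((\<lambda>t. f (\<gamma> t)) has_derivative (\<lambda>t. f' (t *\<^sub>R v))) (at 0 within {-e<..<e})"
    proof (rule has_derivative_in_compose[OF g])
      show "(f has_derivative f') (at (\<gamma> 0) within \<gamma> ` {-e<..<e})"
        unfolding e(3) by (rule has_derivative_subset[OF f e(2)])
    qed
    then have "((\<lambda>t. f (\<gamma> t)) has_derivative (\<lambda>t. f' (t *\<^sub>R v))) (at 0)"
      using at_within_open[of 0 "{-e<..<e}"] e(1) by auto
    then show ?thesis
      by (simp add: has_vector_derivative_def linear_simps(5)[OF has_derivative_bounded_linear[OF f]])
  qed
  obtain \<gamma> where \<gamma>: "curve_through M x v \<gamma>" using v unfolding tangent_space_def by blast
  show ?thesis
    unfolding dir_deriv_def
    by (rule the_equality) (use der \<gamma> vector_derivative_unique_at in blast)+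
qed

lemma smooth_extension_has_derivative:
  assumes U: "open U" "smooth_on U F" "\<And>y. y \<in> U \<Longrightarrow> y \<in> M \<Longrightarrow> F y = f y"
    and x: "x \<in> U" "x \<in> M"
  shows "(f has_derivative blinfun_apply (blinfun_deriv F x)) (at x within M)"
proof -
  have F: "(F has_derivative blinfun_apply (blinfun_deriv F x)) (at x within M)"
    using smooth_on_has_derivative[OF U(2) x(1)] by (rule has_derivative_at_withinI)
  obtain d where d: "d > 0" "ball x d \<subseteq> U" using U x openE by blast
  show ?thesis
    by (rule has_derivative_transform_within[OF F d(1) x(2)])
       (use U(3) d(2) in \<open>auto simp: dist_commute subset_iff\<close>)
qed

lemma smooth_map_differentiable:
  assumes "smooth_map M f" "x \<in> M"
  shows "f differentiable (at x within M)"
proof -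
  obtain U F where "open U" "x \<in> U" "smooth_on U F" "\<forall>y\<in>U \<inter> M. F y = f y"
    using assms unfolding smooth_map_def by blast
  then show ?thesis
    using smooth_extension_has_derivative[of U F M f x] assms(2)
    unfolding differentiable_def by blast
qed

section \<open>Slice charts and tangent spaces\<close>

lemma subspace_bounded_projection:
  fixes S :: "'a::euclidean_space set"
  assumes "subspace S"
  obtains P :: "'a \<Rightarrow> 'a" where "bounded_linear P" "\<And>z. P z \<in> S" "\<And>s. s \<in> S \<Longrightarrow> P s = s"
proof -
  obtain P :: "'a \<Rightarrow> 'a" where "range P \<subseteq> S" "linear P" "\<forall>s\<in>S. P (id s) = s"
    using linear_exists_left_inverse_on[OF linear_id assms] by auto
  then show thesis
    by (intro that[of P]) (auto simp: linear_conv_bounded_linear)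
qed

locale slice_chart =
  fixes M U V S :: "'a::euclidean_space set" and \<phi> \<psi> :: "'a \<Rightarrow> 'a"
  assumes open_U: "open U" and open_V: "open V"
    and homeo: "homeomorphism U V \<phi> \<psi>"
    and smooth_\<phi>: "smooth_on U \<phi>" and smooth_\<psi>: "smooth_on V \<psi>"
    and subspace_S: "subspace S"
    and slice: "\<phi> ` (U \<inter> M) = V \<inter> S"
begin

lemma \<psi>_\<phi>: "y \<in> U \<Longrightarrow> \<psi> (\<phi> y) = y" and \<phi>_\<psi>: "z \<in> V \<Longrightarrow> \<phi> (\<psi> z) = z"
  and \<phi>_in: "y \<in> U \<Longrightarrow> \<phi> y \<in> V" and \<psi>_in: "z \<in> V \<Longrightarrow> \<psi> z \<in> U"
  using homeo unfolding homeomorphism_def by blast+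

lemma \<phi>_slice: "y \<in> U \<Longrightarrow> y \<in> M \<Longrightarrow> \<phi> y \<in> S"
  using slice by blast

lemma \<psi>_slice: "z \<in> V \<Longrightarrow> z \<in> S \<Longrightarrow> \<psi> z \<in> M"
proof -
  assume "z \<in> V" "z \<in> S"
  then have "z \<in> \<phi> ` (U \<inter> M)" using slice by blast
  then show "\<psi> z \<in> M" using \<psi>_\<phi> by auto
qed

lemmas deriv_\<phi> = smooth_on_has_derivative[OF smooth_\<phi>]
lemmas deriv_\<psi> = smooth_on_has_derivative[OF smooth_\<psi>]

lemma D\<phi>_D\<psi>:
  assumes "y \<in> U"
  shows "blinfun_apply (blinfun_deriv \<phi> y) (blinfun_apply (blinfun_deriv \<psi> (\<phi> y)) v) = v"
proof -
  have "(\<psi> has_derivative blinfun_apply (blinfun_deriv \<psi> (\<phi> y))) (at (\<phi> y))"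
       "(\<phi> has_derivative blinfun_apply (blinfun_deriv \<phi> y)) (at (\<psi> (\<phi> y)))"
    using deriv_\<phi> deriv_\<psi> assms \<phi>_in \<psi>_\<phi> by auto
  from has_derivative_compose[OF this]
  have "((\<lambda>z. z) has_derivative (\<lambda>v. blinfun_apply (blinfun_deriv \<phi> y) (blinfun_apply (blinfun_deriv \<psi> (\<phi> y)) v)))
      (at (\<phi> y))"
    by (rule has_derivative_transform_within_open[OF _ open_V]) (use assms \<phi>_in \<phi>_\<psi> in auto)
  from has_derivative_unique[OF this has_derivative_ident] show ?thesis by metis
qed

lemma D\<psi>_D\<phi>:
  assumes "y \<in> U"
  shows "blinfun_apply (blinfun_deriv \<psi> (\<phi> y)) (blinfun_apply (blinfun_deriv \<phi> y) v) = v"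
proof -
  from has_derivative_compose[OF deriv_\<phi>[OF assms] deriv_\<psi>[OF \<phi>_in[OF assms]]]
  have "((\<lambda>z. z) has_derivative (\<lambda>v. blinfun_apply (blinfun_deriv \<psi> (\<phi> y)) (blinfun_apply (blinfun_deriv \<phi> y) v))) (at y)"
    by (rule has_derivative_transform_within_open[OF _ open_U]) (use assms \<psi>_\<phi> in auto)
  from has_derivative_unique[OF this has_derivative_ident] show ?thesis by metis
qed

text \<open>
  The images of straight lines in the slice are the curves that realise all tangent vectors.
\<close>

lemma curve_through_slice:
  assumes y: "y \<in> U" "y \<in> M" and s: "s \<in> S"
  shows "curve_through M y (blinfun_apply (blinfun_deriv \<psi> (\<phi> y)) s) (\<lambda>t. \<psi> (\<phi> y + t *\<^sub>R s))"
proof -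
  have "open ((\<lambda>t. \<phi> y + t *\<^sub>R s) -` V)"
    by (intro open_vimage open_V continuous_intros)
  moreover have "0 \<in> (\<lambda>t. \<phi> y + t *\<^sub>R s) -` V" using \<phi>_in y by simp
  ultimately obtain e where e: "e > 0" "ball 0 e \<subseteq> (\<lambda>t. \<phi> y + t *\<^sub>R s) -` V"
    by (meson openE)
  have V: "\<phi> y + t *\<^sub>R s \<in> V" if "t \<in> {-e<..<e}" for t
    using e(2) that by (auto simp: subset_iff dist_real_def)
  have "smooth_on {-e<..<e} (\<lambda>t. \<psi> (\<phi> y + t *\<^sub>R s))"
    unfolding smooth_on_def
  proof
    fix k
    show "Ck_on k {-e<..<e} (\<lambda>t. \<psi> (\<phi> y + t *\<^sub>R s))"
      using Ck_on_along_line[OF _ V, of "{-e<..<e}" k \<psi> 1] smooth_\<psi> unfolding smooth_on_def by simp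
  qed
  moreover have "(\<lambda>t. \<psi> (\<phi> y + t *\<^sub>R s)) ` {-e<..<e} \<subseteq> M"
  proof clarify
    fix t assume "t \<in> {-e<..<e}"
    then show "\<psi> (\<phi> y + t *\<^sub>R s) \<in> M"
      by (intro \<psi>_slice V subspace_add subspace_scale subspace_S \<phi>_slice y s)
  qed
  moreover have "((\<lambda>t. \<psi> (\<phi> y + t *\<^sub>R s)) has_vector_derivative (blinfun_apply (blinfun_deriv \<psi> (\<phi> y)) s)) (at 0)"
  proof -
    have l: "((\<lambda>t. \<phi> y + t *\<^sub>R s) has_derivative (\<lambda>t. t *\<^sub>R s)) (at 0)"
      by (auto intro!: derivative_eq_intros)
    have "(\<psi> has_derivative blinfun_apply (blinfun_deriv \<psi> (\<phi> y))) (at (\<phi> y + 0 *\<^sub>R s))"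
      using deriv_\<psi> \<phi>_in y by simp
    from has_derivative_compose[OF l this] show ?thesis
      by (simp add: has_vector_derivative_def blinfun.scaleR_right)
  qed
  ultimately show ?thesis
    using e(1) y \<psi>_\<phi> unfolding curve_through_def by auto
qed

text \<open>
  For a curve in \<open>M\<close> its image under the chart stays in \<open>S\<close>, so it is unchanged by a linear projection
  onto \<open>S\<close>, and therefore so is its velocity. The other inclusion is given by the images of lines.
\<close>

lemma tangent_space_eq:
  assumes y: "y \<in> U" "y \<in> M"
  shows "tangent_space M y = {v. blinfun_apply (blinfun_deriv \<phi> y) v \<in> S}"
proof (intro equalityI subsetI)
  fix v assume "v \<in> tangent_space M y"
  obtain P :: "'a \<Rightarrow> 'a" where P: "bounded_linear P" "\<And>z. P z \<in> S" "\<And>s. s \<in> S \<Longrightarrow> P s = s"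
    using subspace_bounded_projection[OF subspace_S] by metis
  from \<open>v \<in> tangent_space M y\<close> obtain \<gamma> e where \<gamma>: "e > 0" "\<gamma> ` {-e<..<e} \<subseteq> M" "\<gamma> 0 = y" "(\<gamma> has_vector_derivative v) (at 0)"
    unfolding tangent_space_def curve_through_def by blast
  have "(\<phi> has_derivative blinfun_apply (blinfun_deriv \<phi> y)) (at (\<gamma> 0))"
    using deriv_\<phi> y \<gamma> by simp
  from has_derivative_compose[OF \<gamma>(4)[unfolded has_vector_derivative_def] this]
  have der: "((\<lambda>t. \<phi> (\<gamma> t)) has_vector_derivative (blinfun_apply (blinfun_deriv \<phi> y) v)) (at 0)"
    by (simp add: has_vector_derivative_def blinfun.scaleR_right)
  have cont: "(\<gamma> \<longlongrightarrow> \<gamma> 0) (at 0)"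
    using has_vector_derivative_continuous[OF \<gamma>(4)] by (simp add: continuous_at)
  have "\<forall>\<^sub>F t in at 0. \<gamma> t \<in> U"
    using topological_tendstoD[OF cont open_U] y \<gamma>(3) by simp
  moreover have "\<forall>\<^sub>F t in at 0. t \<in> {-e<..<e}"
    using \<gamma>(1) by (intro eventually_at_in_open') auto
  ultimately have near: "\<forall>\<^sub>F t in at 0. \<phi> (\<gamma> t) = P (\<phi> (\<gamma> t))"
  proof eventually_elim
    case (elim t)
    then have "\<gamma> t \<in> M" using \<gamma>(2) by blast
    then show ?case using P(3)[OF \<phi>_slice] elim by simp
  qed
  have zero: "\<phi> (\<gamma> 0) = P (\<phi> (\<gamma> 0))"
    using P(3)[OF \<phi>_slice[OF y]] \<gamma>(3) by simp
  have "((\<lambda>t. P (\<phi> (\<gamma> t))) has_vector_derivative (blinfun_apply (blinfun_deriv \<phi> y) v)) (at 0)"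
    unfolding has_vector_derivative_def
    by (rule has_derivative_transform_eventually[OF der[unfolded has_vector_derivative_def] near zero UNIV_I])
  then have "blinfun_apply (blinfun_deriv \<phi> y) v = P (blinfun_apply (blinfun_deriv \<phi> y) v)"
    by (rule vector_derivative_unique_at[OF _ bounded_linear.has_vector_derivative[OF P(1) der]])
  then have "blinfun_apply (blinfun_deriv \<phi> y) v \<in> S" using P(2) by metis
  then show "v \<in> {v. blinfun_apply (blinfun_deriv \<phi> y) v \<in> S}" by simp
next
  fix v assume "v \<in> {v. blinfun_apply (blinfun_deriv \<phi> y) v \<in> S}"
  from curve_through_slice[OF y this[unfolded mem_Collect_eq]]
  have "\<exists>\<gamma>. curve_through M y v \<gamma>"
    unfolding D\<psi>_D\<phi>[OF y(1)] by (rule exI[of "curve_through M y v"])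
  then show "v \<in> tangent_space M y" unfolding tangent_space_def by simp
qed

lemma D\<psi>_tangent: "y \<in> U \<Longrightarrow> y \<in> M \<Longrightarrow> s \<in> S \<Longrightarrow> blinfun_apply (blinfun_deriv \<psi> (\<phi> y)) s \<in> tangent_space M y"
  by (simp add: tangent_space_eq D\<phi>_D\<psi>)

end

lemma smooth_submanifold_slice_chart:
  fixes M :: "'a::euclidean_space set"
  assumes "smooth_submanifold d M" "x \<in> M"
  obtains U V S :: "'a set" and \<phi> \<psi> :: "'a \<Rightarrow> 'a" where "slice_chart M U V S \<phi> \<psi>" "x \<in> U"
proof -
  from bspec[OF assms(1)[unfolded smooth_submanifold_def] assms(2)] show thesis
    by (elim exE conjE, intro that slice_chart.intro)
qed

lemma subspace_tangent_space:
  fixes M :: "'a::euclidean_space set"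
  assumes "smooth_submanifold d M" "x \<in> M"
  shows "subspace (tangent_space M x)"
proof -
  obtain U V S :: "'a set" and \<phi> \<psi> :: "'a \<Rightarrow> 'a" where "slice_chart M U V S \<phi> \<psi>" and x: "x \<in> U"
    using smooth_submanifold_slice_chart[OF assms] .
  interpret slice_chart M U V S \<phi> \<psi> by fact
  show ?thesis
    unfolding tangent_space_eq[OF x assms(2)]
    by (auto intro!: subspaceI simp: blinfun.bilinear_simps
          subspace_0[OF subspace_S] subspace_add[OF subspace_S] subspace_scale[OF subspace_S])
qed

section \<open>The Lie bracket in ambient terms\<close>

text \<open>
  Extend the test function to a smooth \<open>F\<close> near \<open>x\<close>. Along \<open>M\<close>, the function \<open>D\<^sub>Y f\<close> is
  \<open>y \<mapsto> DF(y) (Y y)\<close>, so the product rule gives \<open>D\<^sub>X (D\<^sub>Y f) = DF(x) (Y' (X x)) + D\<^sup>2F(x)(X x, Y x)\<close>, and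
  the second term is symmetric. Thus \<open>Y' (X x) - X' (Y x)\<close> acts as the commutator. It is the only tangent
  vector that does, since the coordinate functions \<open>y \<mapsto> y \<bullet> b\<close> separate vectors.
\<close>

lemma lie_bracket_eq:
  fixes M :: "'a::euclidean_space set"
  assumes x: "x \<in> M"
    and X: "\<And>y. y \<in> M \<Longrightarrow> X y \<in> tangent_space M y"
    and Y: "\<And>y. y \<in> M \<Longrightarrow> Y y \<in> tangent_space M y"
    and X': "(X has_derivative X') (at x within M)"
    and Y': "(Y has_derivative Y') (at x within M)"
    and tangent: "Y' (X x) - X' (Y x) \<in> tangent_space M x"
  shows "lie_bracket M X Y x = Y' (X x) - X' (Y x)"
proof -
  have commutator: "dir_deriv M f x (Y' (X x) - X' (Y x)) =
      dir_deriv M (\<lambda>y. dir_deriv M f y (Y y)) x (X x) - dir_deriv M (\<lambda>y. dir_deriv M f y (X y)) x (Y x)"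
    if f: "smooth_map M f" for f :: "'a \<Rightarrow> real"
  proof -
    obtain U F where U: "open U" "x \<in> U" and F: "smooth_on U F"
      and eq': "\<forall>y\<in>U \<inter> M. F y = f y"
      using bspec[OF f[unfolded smooth_map_def] x] by (elim exE conjE)
    then have eq: "\<And>y. y \<in> U \<Longrightarrow> y \<in> M \<Longrightarrow> F y = f y" by simp
    obtain D where D: "(blinfun_deriv F has_derivative D) (at x)"
      using smooth_on_blinfun_deriv_differentiable[OF U(1) F U(2)] unfolding differentiable_def by blast
    have first: "dir_deriv M f y v = blinfun_apply (blinfun_deriv F y) v"
      if "y \<in> U" "y \<in> M" "v \<in> tangent_space M y" for y v
      using dir_deriv_eq[OF smooth_extension_has_derivative[OF U(1) F eq that(1,2)] that(3)] .
    have second: "((\<lambda>y. dir_deriv M f y (Z y)) has_derivative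
        (\<lambda>h. blinfun_apply (blinfun_deriv F x) (Z' h) + blinfun_apply (D h) (Z x))) (at x within M)"
      if Z: "\<And>y. y \<in> M \<Longrightarrow> Z y \<in> tangent_space M y" "(Z has_derivative Z') (at x within M)" for Z Z'
    proof -
      obtain d where d: "d > 0" "ball x d \<subseteq> U" using U openE by blast
      have "((\<lambda>y. blinfun_apply (blinfun_deriv F y) (Z y)) has_derivative
        (\<lambda>h. blinfun_apply (blinfun_deriv F x) (Z' h) + blinfun_apply (D h) (Z x))) (at x within M)"
        by (rule blinfun.FDERIV[OF has_derivative_at_withinI[OF D] Z(2)])
      then show ?thesis
        by (rule has_derivative_transform_within[OF _ d(1) x])
           (use first Z(1) d(2) in \<open>auto simp: dist_commute subset_iff\<close>)
    qed
    have "blinfun_apply (D (X x)) (Y x) = blinfun_apply (D (Y x)) (X x)"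
      by (rule second_derivative_symmetric[OF U smooth_on_has_derivative[OF F] D])
    moreover have "dir_deriv M (\<lambda>y. dir_deriv M f y (Y y)) x (X x) =
        blinfun_apply (blinfun_deriv F x) (Y' (X x)) + blinfun_apply (D (X x)) (Y x)"
      by (rule dir_deriv_eq[OF second X[OF x]], erule Y, rule Y')
    moreover have "dir_deriv M (\<lambda>y. dir_deriv M f y (X y)) x (Y x) =
        blinfun_apply (blinfun_deriv F x) (X' (Y x)) + blinfun_apply (D (Y x)) (X x)"
      by (rule dir_deriv_eq[OF second Y[OF x]], erule X, rule X')
    ultimately show ?thesis
      unfolding first[OF U(2) x tangent] by (simp add: blinfun.diff_right)
  qed
  have linear_functional: "smooth_map M (\<lambda>y. y \<bullet> b) \<and> dir_deriv M (\<lambda>y. y \<bullet> b) x v = v \<bullet> b"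
    if "v \<in> tangent_space M x" for b v
  proof
    show "smooth_map M (\<lambda>y. y \<bullet> b)"
      unfolding smooth_map_def using smooth_on_bounded_linear[OF bounded_linear_inner_left] by blast
    show "dir_deriv M (\<lambda>y. y \<bullet> b) x v = v \<bullet> b"
      by (rule dir_deriv_eq[OF bounded_linear_imp_has_derivative[OF bounded_linear_inner_left] that])
  qed
  show ?thesis
    unfolding lie_bracket_def
  proof (rule the_equality)
    fix v assume v: "v \<in> tangent_space M x \<and> (\<forall>f :: 'a \<Rightarrow> real. smooth_map M f \<longrightarrow>
           dir_deriv M f x v =
             dir_deriv M (\<lambda>y. dir_deriv M f y (Y y)) x (X x) -
             dir_deriv M (\<lambda>y. dir_deriv M f y (X y)) x (Y x))"
    show "v = Y' (X x) - X' (Y x)"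
    proof (rule euclidean_eqI)
      fix b :: 'a
      note v1 = conjunct1[OF v] and v2 = conjunct2[OF v]
      have "smooth_map M (\<lambda>y. y \<bullet> b)" using linear_functional[OF v1] ..
      from v2[rule_format, OF this] commutator[OF this]
      have "dir_deriv M (\<lambda>y. y \<bullet> b) x v = dir_deriv M (\<lambda>y. y \<bullet> b) x (Y' (X x) - X' (Y x))"
        by (rule trans[OF _ sym])
      then show "v \<bullet> b = (Y' (X x) - X' (Y x)) \<bullet> b"
        using linear_functional[OF v1, of b] linear_functional[OF tangent, of b] by metis
    qed
  qed (use commutator tangent in blast)
qed

section \<open>Differentiating a field of projections\<close>

text \<open>
  The vector \<open>w\<close> is the second derivative of the parametrisation \<open>\<psi>\<close> in the directions that correspond to
  \<open>\<xi>\<close> and \<open>\<eta>\<close>. The two equations are the derivative of \<open>Q (\<psi> z) (D\<psi>(z) s) = D\<psi>(z) s\<close>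
  along the slice, so every field of projections onto the tangent spaces has this symmetry, whatever its kernels.
\<close>

lemma (in slice_chart) derivative_fixing_tangent_vectors:
  fixes Q :: "'a \<Rightarrow> 'a \<Rightarrow>\<^sub>L 'a"
  assumes x: "x \<in> U" "x \<in> M"
    and fix_tangent: "\<And>y u. y \<in> M \<Longrightarrow> u \<in> tangent_space M y \<Longrightarrow> blinfun_apply (Q y) u = u"
    and Q: "(Q has_derivative Q') (at x within M)"
    and \<xi>: "\<xi> \<in> tangent_space M x" and \<eta>: "\<eta> \<in> tangent_space M x"
  obtains w where "blinfun_apply (Q' \<xi>) \<eta> = w - blinfun_apply (Q x) w"
    "blinfun_apply (Q' \<eta>) \<xi> = w - blinfun_apply (Q x) w"
proof -
  define z where "z = \<phi> x"
  let ?J = "blinfun_apply (blinfun_deriv \<psi> z)" and ?K = "blinfun_apply (blinfun_deriv \<phi> x)"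
  have z: "z \<in> V" "z \<in> S" using x \<phi>_in \<phi>_slice z_def by auto
  obtain D where D: "(blinfun_deriv \<psi> has_derivative D) (at z)"
    using smooth_on_blinfun_deriv_differentiable[OF open_V smooth_\<psi> z(1)] unfolding differentiable_def by blast
  have key: "blinfun_apply (Q' (?J r)) (?J s) = blinfun_apply (D r) s - blinfun_apply (Q x) (blinfun_apply (D r) s)"
    if r: "r \<in> S" and s: "s \<in> S" for r s
  proof -
    let ?\<gamma> = "\<lambda>t. \<psi> (z + t *\<^sub>R r)" and ?k = "\<lambda>t. blinfun_apply (blinfun_deriv \<psi> (z + t *\<^sub>R r)) s"
    obtain e where e: "e > 0" "?\<gamma> ` {-e<..<e} \<subseteq> M" and \<gamma>0: "?\<gamma> 0 = x"
      and \<gamma>: "(?\<gamma> has_derivative (\<lambda>t. t *\<^sub>R ?J r)) (at 0)"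
      using curve_through_slice[OF x r] unfolding curve_through_def has_vector_derivative_def z_def by blast
    have "(Q has_derivative Q') (at (?\<gamma> 0) within ?\<gamma> ` {-e<..<e})"
      unfolding \<gamma>0 by (rule has_derivative_subset[OF Q e(2)])
    from has_derivative_in_compose[OF has_derivative_at_withinI[OF \<gamma>] this]
    have Q\<gamma>: "((\<lambda>t. Q (?\<gamma> t)) has_derivative (\<lambda>t. Q' (t *\<^sub>R ?J r))) (at 0)"
      using at_within_open[of 0 "{-e<..<e}"] e(1) by auto
    have line: "((\<lambda>t. z + t *\<^sub>R r) has_derivative (\<lambda>t. t *\<^sub>R r)) (at 0)"
      by (auto intro!: derivative_eq_intros)
    have "(blinfun_deriv \<psi> has_derivative D) (at (z + 0 *\<^sub>R r))" using D by simp
    from has_derivative_compose[OF line this]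
    have "((\<lambda>t. blinfun_deriv \<psi> (z + t *\<^sub>R r)) has_derivative (\<lambda>t. D (t *\<^sub>R r))) (at 0)" .
    from bounded_linear.has_derivative[OF blinfun.bounded_linear_left this]
    have k: "(?k has_derivative (\<lambda>t. blinfun_apply (D (t *\<^sub>R r)) s)) (at 0)" .
    \<comment> \<open>both sides of \<open>Q (\<gamma> t) (k t) = k t\<close> are differentiated at \<open>0\<close> and compared\<close>
    have Qk: "((\<lambda>t. blinfun_apply (Q (?\<gamma> t)) (?k t)) has_derivative
       (\<lambda>t. blinfun_apply (Q (?\<gamma> 0)) (blinfun_apply (D (t *\<^sub>R r)) s) + blinfun_apply (Q' (t *\<^sub>R ?J r)) (?k 0))) (at 0)"
      by (rule blinfun.FDERIV[OF Q\<gamma> k])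
    have "open ((\<lambda>t. z + t *\<^sub>R r) -` V)"
      by (intro open_vimage open_V continuous_intros)
    moreover have "0 \<in> (\<lambda>t. z + t *\<^sub>R r) -` V" using z by simp
    moreover have "blinfun_apply (Q (?\<gamma> t)) (?k t) = ?k t" if "t \<in> (\<lambda>t. z + t *\<^sub>R r) -` V" for t
    proof -
      have V: "z + t *\<^sub>R r \<in> V" using that by simp
      have "z + t *\<^sub>R r \<in> S" by (intro subspace_add subspace_scale subspace_S z r)
      then have "?\<gamma> t \<in> M" using \<psi>_slice V by blast
      then show ?thesis
        using fix_tangent[OF _ D\<psi>_tangent[OF \<psi>_in[OF V] _ s]] \<phi>_\<psi>[OF V] by simp
    qed
    ultimately have "(?k has_derivative
       (\<lambda>t. blinfun_apply (Q (?\<gamma> 0)) (blinfun_apply (D (t *\<^sub>R r)) s) + blinfun_apply (Q' (t *\<^sub>R ?J r)) (?k 0))) (at 0)"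
      by (rule has_derivative_transform_within_open[OF Qk])
    from fun_cong[OF has_derivative_unique[OF k this], of 1] show ?thesis
      using \<gamma>0 by (simp add: algebra_simps)
  qed
  have inv: "?J (?K v) = v" for v using D\<psi>_D\<phi>[OF x(1)] z_def by simp
  have S: "?K \<xi> \<in> S" "?K \<eta> \<in> S" using \<xi> \<eta> tangent_space_eq[OF x] by auto
  have "blinfun_apply (D (?K \<xi>)) (?K \<eta>) = blinfun_apply (D (?K \<eta>)) (?K \<xi>)"
    by (rule second_derivative_symmetric[OF open_V z(1) deriv_\<psi> D])
  then show thesis
    using that[of "blinfun_apply (D (?K \<xi>)) (?K \<eta>)"] key[OF S] key[OF S(2,1)] by (simp only: inv)
qed

text \<open>
  For a basis \<open>B\<close> of \<open>T\<close> the map \<open>w \<mapsto> \<Sum>b\<in>B. (b \<bullet> A w) b\<close> vanishes exactly on the vectors \<open>w\<close> for which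
  \<open>A w\<close> is orthogonal to \<open>T\<close>. By positivity it is injective on \<open>T\<close>, hence maps \<open>T\<close> onto itself, and a preimage
  in \<open>T\<close> of the image of \<open>v\<close> is the projection.
\<close>

lemma positive_projection_ex1:
  fixes A :: "'a::euclidean_space \<Rightarrow>\<^sub>L 'a"
  assumes T: "subspace T"
    and pos: "\<And>u. u \<in> T \<Longrightarrow> u \<noteq> 0 \<Longrightarrow> u \<bullet> blinfun_apply A u > 0"
  shows "\<exists>!w. w \<in> T \<and> (\<forall>u\<in>T. u \<bullet> blinfun_apply A (v - w) = 0)"
proof (rule ex_ex1I)
  obtain B where B: "B \<subseteq> T" "independent B" "T \<subseteq> span B" "card B = dim T"
    using basis_exists by blast
  have fin: "finite B" using B(2) independent_imp_finite by blast
  define f where "f w = (\<Sum>b\<in>B. (b \<bullet> blinfun_apply A w) *\<^sub>R b)" for w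
  have f: "linear f"
    unfolding f_def
    by (rule linearI) (simp_all add: blinfun.bilinear_simps inner_add_right scaleR_add_left sum.distrib scaleR_sum_right)
  have fT: "f w \<in> T" for w
    unfolding f_def using B(1) T by (intro subspace_sum subspace_scale) auto
  have zero: "u \<bullet> blinfun_apply A w = 0" if "f w = 0" "u \<in> T" for u w
  proof -
    have b: "b \<bullet> blinfun_apply A w = 0" if "b \<in> B" for b
      using independentD[OF B(2) fin order.refl, of "\<lambda>b. b \<bullet> blinfun_apply A w" b] \<open>f w = 0\<close> that
      unfolding f_def by blast
    have "orthogonal (blinfun_apply A w) u"
      by (rule orthogonal_to_span[of u B])
         (use b B(3) \<open>u \<in> T\<close> in \<open>auto simp: orthogonal_def inner_commute\<close>)
    then show ?thesis by (simp add: orthogonal_def inner_commute)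
  qed
  have inj: "inj_on f T"
    unfolding linear_inj_on_iff_eq_0[OF f T] using zero pos by (metis less_irrefl)
  have "f ` T = T"
  proof (rule subspace_dim_equal)
    show "subspace (f ` T)" by (rule linear_subspace_image[OF f T])
    show "dim T \<le> dim (f ` T)" using dim_image_eq[OF f, of T] inj T by (simp add: span_eq_iff[THEN iffD2])
  qed (use fT T in auto)
  then obtain w where w: "w \<in> T" "f w = f v" using fT by (metis imageE)
  then have "f (v - w) = 0" using linear_diff[OF f] by simp
  then show "\<exists>w. w \<in> T \<and> (\<forall>u\<in>T. u \<bullet> blinfun_apply A (v - w) = 0)"
    using zero w by blast
next
  fix w w' assume w: "w \<in> T \<and> (\<forall>u\<in>T. u \<bullet> blinfun_apply A (v - w) = 0)"
    and w': "w' \<in> T \<and> (\<forall>u\<in>T. u \<bullet> blinfun_apply A (v - w') = 0)"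
  have "w - w' \<in> T" using w w' T subspace_diff by blast
  moreover have "(w - w') \<bullet> blinfun_apply A (w - w') = (w - w') \<bullet> blinfun_apply A (v - w')
      - (w - w') \<bullet> blinfun_apply A (v - w)"
    by (simp add: blinfun.diff_right inner_diff_right)
  ultimately show "w = w'" using pos[of "w - w'"] w w' by auto
qed

lemma
  fixes M :: "'a::euclidean_space set"
  assumes T: "subspace (tangent_space M y)"
    and pos: "\<And>u. u \<in> tangent_space M y \<Longrightarrow> u \<noteq> 0 \<Longrightarrow> u \<bullet> blinfun_apply (g y) u > 0"
  shows metric_proj_tangent: "blinfun_apply (metric_proj M g y) v \<in> tangent_space M y"
    and metric_proj_orthogonal: "\<And>u. u \<in> tangent_space M y \<Longrightarrow>
      u \<bullet> blinfun_apply (g y) (v - blinfun_apply (metric_proj M g y) v) = 0"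
    and metric_proj_fixes_tangent: "v \<in> tangent_space M y \<Longrightarrow> blinfun_apply (metric_proj M g y) v = v"
proof -
  let ?T = "tangent_space M y"
  let ?is = "\<lambda>v w. w \<in> ?T \<and> (\<forall>u\<in>?T. u \<bullet> blinfun_apply (g y) (v - w) = 0)"
  define p where "p v = (THE w. ?is v w)" for v
  have p: "?is v (p v)" for v
    unfolding p_def by (rule theI'[OF positive_projection_ex1[OF T pos]])
  have p_eq: "p v = w" if "?is v w" for v w
    unfolding p_def by (rule the1_equality[OF positive_projection_ex1[OF T pos] that])
  have "linear p"
  proof (rule linearI)
    fix a b
    show "p (a + b) = p a + p b"
    proof (rule p_eq, intro conjI ballI)
      show "p a + p b \<in> ?T" using p T subspace_add by blast
      fix u assume "u \<in> ?T"
      then have "u \<bullet> blinfun_apply (g y) (a - p a) + u \<bullet> blinfun_apply (g y) (b - p b) = 0"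
        using p by simp
      then show "u \<bullet> blinfun_apply (g y) (a + b - (p a + p b)) = 0"
        by (simp add: blinfun.bilinear_simps inner_diff_right inner_add_right)
    qed
  next
    fix c a
    show "p (c *\<^sub>R a) = c *\<^sub>R p a"
    proof (rule p_eq, intro conjI ballI)
      show "c *\<^sub>R p a \<in> ?T" using p T subspace_scale by blast
      fix u assume "u \<in> ?T"
      then have "c * (u \<bullet> blinfun_apply (g y) (a - p a)) = 0"
        using p by simp
      then show "u \<bullet> blinfun_apply (g y) (c *\<^sub>R a - c *\<^sub>R p a) = 0"
        by (simp add: blinfun.bilinear_simps flip: scaleR_diff_right)
    qed
  qed
  then have proj_eq: "blinfun_apply (metric_proj M g y) = p"
    unfolding metric_proj_def p_def[symmetric]
    by (simp add: linear_conv_bounded_linear bounded_linear_Blinfun_apply)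
  show "blinfun_apply (metric_proj M g y) v \<in> ?T"
    and "\<And>u. u \<in> ?T \<Longrightarrow> u \<bullet> blinfun_apply (g y) (v - blinfun_apply (metric_proj M g y) v) = 0"
    unfolding proj_eq using p by auto
  show "blinfun_apply (metric_proj M g y) v = v" if "v \<in> ?T"
    unfolding proj_eq by (rule p_eq) (use that in simp)
qed

lemma differentiable_bounded_linear:
  "bounded_linear T \<Longrightarrow> f differentiable F \<Longrightarrow> (\<lambda>y. T (f y)) differentiable F"
  unfolding differentiable_def using bounded_linear.has_derivative by blast

text \<open>
  With \<open>J\<close> and \<open>K\<close> the derivatives of the parametrisation and of the chart and \<open>P\<close> a linear
  projection onto \<open>S\<close>, put
  \<open>\<Lambda>\<^sub>y u = (\<Sum>b. (J\<^sub>y (P b) \<bullet> g\<^sub>y u) b, K\<^sub>y u - P (K\<^sub>y u))\<close>. The first component tests \<open>u\<close> against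
  the tangent vectors \<open>J\<^sub>y s\<close>, and the second vanishes iff \<open>u\<close> is tangent. Hence \<open>\<Pi>\<^sub>y v\<close> solves
  \<open>\<Lambda>\<^sub>y p = (first component of \<Lambda>\<^sub>y v, 0)\<close>. Moreover \<open>\<Lambda>\<^sub>x\<close> is injective, because an element of
  its kernel is tangent and \<open>g\<close>-orthogonal to itself. All coefficients involve first derivatives of smooth maps
  only, so they are differentiable.
\<close>

lemma metric_proj_differentiable:
  fixes M :: "'a::euclidean_space set"
  assumes M: "smooth_submanifold d M" and x: "x \<in> M"
    and g: "g differentiable (at x within M)"
    and pos: "\<And>y u. y \<in> M \<Longrightarrow> u \<noteq> 0 \<Longrightarrow> u \<bullet> blinfun_apply (g y) u > 0"
  shows "metric_proj M g differentiable (at x within M)"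
proof -
  obtain U V S :: "'a set" and \<phi> \<psi> :: "'a \<Rightarrow> 'a" where "slice_chart M U V S \<phi> \<psi>" and xU: "x \<in> U"
    using smooth_submanifold_slice_chart[OF M x] .
  interpret slice_chart M U V S \<phi> \<psi> by fact
  obtain P :: "'a \<Rightarrow> 'a" where P: "bounded_linear P" "\<And>z. P z \<in> S" "\<And>s. s \<in> S \<Longrightarrow> P s = s"
    using subspace_bounded_projection[OF subspace_S] by metis
  interpret P: bounded_linear P by fact
  let ?J = "\<lambda>y. blinfun_deriv \<psi> (\<phi> y)" and ?K = "\<lambda>y. blinfun_deriv \<phi> y"
  define A where "A y u = (\<Sum>b\<in>Basis. (blinfun_apply (?J y) (P b) \<bullet> blinfun_apply (g y) u) *\<^sub>R b)" for y u
  define \<Lambda> where "\<Lambda> y u = (A y u, blinfun_apply (?K y) u - P (blinfun_apply (?K y) u))" for y u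
  have A_bl: "bounded_linear (A y)" for y
    unfolding linear_conv_bounded_linear[symmetric] A_def
    by (rule linearI) (simp_all add: blinfun.bilinear_simps inner_add_right scaleR_add_left sum.distrib scaleR_sum_right)
  have \<Lambda>_bl: "bounded_linear (\<Lambda> y)" for y
    unfolding \<Lambda>_def
    by (intro bounded_linear_Pair A_bl bounded_linear_sub blinfun.bounded_linear_right
          bounded_linear_compose[OF P(1) blinfun.bounded_linear_right])
  have A_zero: "blinfun_apply (?J y) s \<bullet> blinfun_apply (g y) u = 0" if "A y u = 0" "s \<in> S" for y u s
  proof -
    have b: "blinfun_apply (?J y) (P b) \<bullet> blinfun_apply (g y) u = 0" if "b \<in> Basis" for b
    proof -
      have "A y u \<bullet> b = blinfun_apply (?J y) (P b) \<bullet> blinfun_apply (g y) u"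
        unfolding A_def using that by simp
      then show ?thesis using \<open>A y u = 0\<close> by simp
    qed
    have "s = (\<Sum>b\<in>Basis. (s \<bullet> b) *\<^sub>R P b)"
      using P(3)[OF \<open>s \<in> S\<close>] euclidean_representation[of s] by (metis (no_types, lifting) P.scaleR P.sum sum.cong)
    then have "blinfun_apply (?J y) s = (\<Sum>b\<in>Basis. (s \<bullet> b) *\<^sub>R blinfun_apply (?J y) (P b))"
      by (metis (no_types, lifting) blinfun.sum_right blinfun.scaleR_right sum.cong)
    then show ?thesis by (simp add: inner_sum_left b)
  qed
  have diff_J: "?J differentiable (at x within M)"
    by (rule differentiable_compose[where f = "blinfun_deriv \<psi>" and g = \<phi>, OF smooth_on_blinfun_deriv_differentiable[OF open_V smooth_\<psi> \<phi>_in[OF xU]]])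
       (rule differentiableI[OF has_derivative_at_withinI[OF deriv_\<phi>[OF xU]]])
  have diff_K: "?K differentiable (at x within M)"
    by (rule differentiable_at_withinI[OF smooth_on_blinfun_deriv_differentiable[OF open_U smooth_\<phi> xU]])
  have diff_A: "(\<lambda>y. A y u) differentiable (at x within M)" for u
  proof -
    have ap: "(\<lambda>y. blinfun_apply (h y) c) differentiable (at x within M)"
      if "h differentiable (at x within M)" for c and h :: "'a \<Rightarrow> 'a \<Rightarrow>\<^sub>L 'a"
      by (rule differentiable_bounded_linear[OF blinfun.bounded_linear_left that])
    have "(\<lambda>y. blinfun_apply (?J y) (P b) \<bullet> blinfun_apply (g y) u) differentiable (at x within M)" for b
      using ap[OF diff_J, of "P b"] ap[OF g, of u] has_derivative_inner
      unfolding differentiable_def by blast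
    then show ?thesis unfolding A_def by (intro differentiable_sum ballI differentiable_scaleR) auto
  qed
  have diff_\<Lambda>: "(\<lambda>y. \<Lambda> y u) differentiable (at x within M)" for u
  proof -
    have "(\<lambda>y. blinfun_apply (?K y) u) differentiable (at x within M)"
      by (rule differentiable_bounded_linear[OF blinfun.bounded_linear_left diff_K])
    then have "(\<lambda>y. blinfun_apply (?K y) u - P (blinfun_apply (?K y) u)) differentiable (at x within M)"
      by (intro differentiable_diff differentiable_bounded_linear[OF P(1)])
    then show ?thesis
      using diff_A[of u] has_derivative_Pair unfolding \<Lambda>_def differentiable_def by blast
  qed
  define L where "L y = Blinfun (\<Lambda> y)" for y
  have L: "blinfun_apply (L y) = \<Lambda> y" for y
    unfolding L_def by (rule bounded_linear_Blinfun_apply[OF \<Lambda>_bl])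
  have diff_L: "L differentiable (at x within M)"
    by (rule blinfun_differentiable_componentwise) (simp add: L diff_\<Lambda>)
  have "inj (\<Lambda> x)"
    unfolding linear_injective_0[OF bounded_linear.linear[OF \<Lambda>_bl]]
  proof (intro allI impI)
    fix u assume "\<Lambda> x u = 0"
    then have A0: "A x u = 0" and K0: "blinfun_apply (?K x) u = P (blinfun_apply (?K x) u)"
      by (auto simp: \<Lambda>_def zero_prod_def)
    have "blinfun_apply (?K x) u \<in> S" using K0 P(2) by metis
    from A_zero[OF A0 this] have "u \<bullet> blinfun_apply (g x) u = 0"
      by (simp only: D\<psi>_D\<phi>[OF xU])
    then show "u = 0" using pos[OF x, of u] by force
  qed
  then obtain C where C: "linear C" "C \<circ> \<Lambda> x = id"
    using linear_injective_left_inverse[OF bounded_linear.linear[OF \<Lambda>_bl]] by blast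
  have inv: "Blinfun C o\<^sub>L L x = id_blinfun"
    using C by (intro blinfun_eqI) (simp add: L linear_conv_bounded_linear bounded_linear_Blinfun_apply pointfree_idE)
  have eq: "\<Lambda> y (blinfun_apply (metric_proj M g y) v) = (A y v, 0)" if y: "y \<in> U" "y \<in> M" for y v
  proof -
    note T = subspace_tangent_space[OF M y(2)]
    let ?p = "blinfun_apply (metric_proj M g y) v"
    have "blinfun_apply (?J y) (P b) \<bullet> blinfun_apply (g y) (v - ?p) = 0" for b
      using metric_proj_orthogonal[of M y g "blinfun_apply (?J y) (P b)" v] T pos[OF y(2)]
        D\<psi>_tangent[OF y P(2)] by blast
    then have "A y ?p = A y v"
      unfolding A_def by (simp add: blinfun.diff_right inner_diff_right)
    moreover have "blinfun_apply (?K y) ?p \<in> S"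
      using metric_proj_tangent[of M y g v] T pos[OF y(2)] tangent_space_eq[OF y] by blast
    ultimately show ?thesis by (simp add: \<Lambda>_def P(3))
  qed
  show ?thesis
  proof (rule blinfun_differentiable_componentwise)
    fix v :: 'a
    have "(\<lambda>y. blinfun_apply (metric_proj M g y) v) differentiable (at x within U \<inter> M)"
    proof (rule linear_solution_differentiable[where L = L and R = "\<lambda>y. (A y v, 0 :: 'a)" and C = "Blinfun C"])
      show "L differentiable (at x within U \<inter> M)"
        by (rule differentiable_subset[OF diff_L]) simp
      have "(\<lambda>y. (A y v, 0 :: 'a)) differentiable (at x within M)"
        using diff_A[of v] has_derivative_Pair[OF _ has_derivative_const] unfolding differentiable_def by blast
      then show "(\<lambda>y. (A y v, 0 :: 'a)) differentiable (at x within U \<inter> M)"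
        by (rule differentiable_subset) simp
    qed (use eq x xU L inv in auto)
    then show "(\<lambda>y. blinfun_apply (metric_proj M g y) v) differentiable (at x within M)"
      using at_within_nhd[OF xU open_U, of M "U \<inter> M"] by (simp add: Int_ac)
  qed
qed

theorem lemma4p4:
  fixes M :: "'a::euclidean_space set"
    and \<rho> :: "'a \<Rightarrow> 'a \<Rightarrow> 'a \<Rightarrow> real"
    and g :: "'a \<Rightarrow> 'a \<Rightarrow>\<^sub>L 'a"
    and x \<xi> \<eta> :: 'a
  assumes "embedded_ambient_structure M \<rho> g"
    and "x \<in> M"
    and "\<xi> \<in> tangent_space M x"
    and "\<eta> \<in> tangent_space M x"
  shows "proj_field M g \<xi> x = \<xi> \<and>
         proj_field M g \<eta> x = \<eta> \<and>
         blinfun_apply (metric_proj M g x) (dir_deriv M (proj_field M g \<eta>) x \<xi>) = 0 \<and>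
         lie_bracket M (proj_field M g \<xi>) (proj_field M g \<eta>) x = 0 \<and>
         blinfun_apply (dir_deriv M (metric_proj M g) x \<xi>) \<eta> =
           blinfun_apply (dir_deriv M (metric_proj M g) x \<eta>) \<xi>"
proof -
  note x = assms(2) and \<xi> = assms(3) and \<eta> = assms(4)
  let ?\<Pi> = "metric_proj M g"
  obtain d where M: "smooth_submanifold d M" and g: "metric_operator M \<rho> g"
    using assms(1) unfolding embedded_ambient_structure_def by blast
  have pos: "\<And>y u. y \<in> M \<Longrightarrow> u \<noteq> 0 \<Longrightarrow> u \<bullet> blinfun_apply (g y) u > 0"
    using g unfolding metric_operator_def by blast
  have g_smooth: "smooth_map M g"
    using g unfolding metric_operator_def by blast
  have fixed: "blinfun_apply (?\<Pi> y) u = u" if "y \<in> M" "u \<in> tangent_space M y" for y u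
    using metric_proj_fixes_tangent[of M y g u] subspace_tangent_space[OF M that(1)] pos[OF that(1)] that(2)
    by blast
  have tangent: "proj_field M g v y \<in> tangent_space M y" if "y \<in> M" for v y
    unfolding proj_field_def
    using metric_proj_tangent[of M y g v] subspace_tangent_space[OF M that] pos[OF that] by blast
  obtain \<Pi>' where \<Pi>': "(?\<Pi> has_derivative \<Pi>') (at x within M)"
    using metric_proj_differentiable[OF M x smooth_map_differentiable[OF g_smooth x] pos]
    unfolding differentiable_def by blast
  have field': "(proj_field M g v has_derivative (\<lambda>h. blinfun_apply (\<Pi>' h) v)) (at x within M)" for v
    unfolding proj_field_def by (rule bounded_linear.has_derivative[OF blinfun.bounded_linear_left \<Pi>'])
  obtain U V S :: "'a set" and \<phi> \<psi> :: "'a \<Rightarrow> 'a" where "slice_chart M U V S \<phi> \<psi>" and xU: "x \<in> U"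
    using smooth_submanifold_slice_chart[OF M x] .
  interpret slice_chart M U V S \<phi> \<psi> by fact
  obtain w where w: "blinfun_apply (\<Pi>' \<xi>) \<eta> = w - blinfun_apply (?\<Pi> x) w"
    "blinfun_apply (\<Pi>' \<eta>) \<xi> = w - blinfun_apply (?\<Pi> x) w"
    using derivative_fixing_tangent_vectors[OF xU x fixed \<Pi>' \<xi> \<eta>] by blast
  have at_x: "proj_field M g \<xi> x = \<xi>" "proj_field M g \<eta> x = \<eta>"
    using fixed x \<xi> \<eta> unfolding proj_field_def by auto
  have "blinfun_apply (?\<Pi> x) (dir_deriv M (proj_field M g \<eta>) x \<xi>) = 0"
    unfolding dir_deriv_eq[OF field' \<xi>] w
    using fixed[OF x tangent[OF x, of w]] by (simp add: blinfun.diff_right proj_field_def)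
  moreover have "lie_bracket M (proj_field M g \<xi>) (proj_field M g \<eta>) x = 0"
  proof -
    have zero: "blinfun_apply (\<Pi>' (proj_field M g \<xi> x)) \<eta> - blinfun_apply (\<Pi>' (proj_field M g \<eta> x)) \<xi> = 0"
      unfolding at_x w by simp
    show ?thesis
      using lie_bracket_eq[OF x tangent tangent field' field', of \<xi> \<eta>] zero
        subspace_0[OF subspace_tangent_space[OF M x]] by simp
  qed
  moreover have "blinfun_apply (dir_deriv M ?\<Pi> x \<xi>) \<eta> = blinfun_apply (dir_deriv M ?\<Pi> x \<eta>) \<xi>"
    unfolding dir_deriv_eq[OF \<Pi>' \<xi>] dir_deriv_eq[OF \<Pi>' \<eta>] w ..
  ultimately show ?thesis using at_x by blast
qed

end
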